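(* Consider the fully discrete (forward Euler) DGSEM scheme for the Baer–Nunziato model described in the context, with time step $\Delta t>0$, mesh size $h$ and $\lambda=\Delta t/h$. Assume that the nodal states at time $t^{(n)}$ satisfy $\rho^{k,n}_{i,j}>0$ and $\alpha^{k,n}_{i,j}>0$ for all $j\in\mathbb Z$, $0\le k\le p$, $i=1,2$, and let $\beta_s$ in the numerical flux be defined locally at each element interface by $$\beta_{s_{j+1/2}}:=\max_{i=1,2}\big(|u^{p,n}_{i,j}|,|u^{0,n}_{i,j+1}|\big).$$ Assume the CFL condition $$\lambda\max_{j\in\mathbb Z}\max_{i=1,2}\Bigg(\max_{0\le k\le p}\frac1{\omega_k}\Big(\langle u_{I,h}^{(n)},d_x\phi^k_j\rangle^p_j+\delta_{kp}\frac{\beta_{s_{j+1/2}}-u^{p,n}_{I,j}}2+\delta_{k0}\frac{\beta_{s_{j-1/2}}+u^{0,n}_{I,j}}2\Big),$$ $$\frac1{\omega_0}\Big(\frac{(\beta_{s_{j-1/2}}-\overline u_{i,j-1/2})\hat\rho_{i,j-1/2}}{2\rho^{0,n}_{i,j}}+\frac{\epsilon_{\nu_{j-1/2}}}{\alpha^{0,n}_{i,j}}\Big),\ \frac1{\omega_p}\Big(\frac{(\beta_{s_{j+1/2}}+\overline u_{i,j+1/2})\hat\rho_{i,j+1/2}}{2\rho^{p,n}_{i,j}}+\frac{\epsilon_{\nu_{j+1/2}}}{\alpha^{p,n}_{i,j}}\Big)\Bigg)<\frac12,$$ where $\overline u_{i,j+1/2}=\frac{u^{p,n}_{i,j}+u^{0,n}_{i,j+1}}2$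 and $\hat\rho_{i,j+1/2}=\frac{\rho^{0,n}_{i,j+1}-\rho^{p,n}_{i,j}}{\ln\rho^{0,n}_{i,j+1}-\ln\rho^{p,n}_{i,j}}$. Then the cell averages at time $t^{(n+1)}$ satisfy $$\langle\alpha_{i,h}\rho_{i,h}\rangle^{(n+1)}_j>0,\qquad\langle\alpha_{i,h}\rangle^{(n+1)}_j>0,\qquad i=1,2,\ j\in\mathbb Z.$$ Furthermore, $$\langle\alpha_{i,h}\rangle^{(n+1)}_j=\sum_{k=0}^p\Big(\frac{\omega_k}2-\lambda\Big(\langle u_{I,h}^{(n)},d_x\phi^k_j\rangle^p_j+\delta_{kp}\frac{\beta_{s_{j+1/2}}-u^{p,n}_{I,j}}2+\delta_{k0}\frac{\beta_{s_{j-1/2}}+u^{0,n}_{I,j}}2\Big)\Big)\alpha^{k,n}_{i,j}+\lambda\frac{\beta_{s_{j+1/2}}-u^{p,n}_{I,j}}2\alpha^{0,n}_{i,j+1}+\lambda\frac{\beta_{s_{j-1/2}}+u^{0,n}_{I,j}}2\alpha^{p,n}_{i,j-1},$$ and this is a convex combination of the nodal values (degrees of freedom) $\alpha^{k,n}_{i,j}$ ($0\le k\le p$), $\alpha^{0,n}_{i,j+1}$, $\alpha^{p,n}_{i,j-1}$ at time $t^{(n)}$.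
   Context: **Model.** Fix constants $C_{v,i}>0$, $\gamma_i>1$, $p_{\infty,i}\ge0$ ($i=1,2$), $\chi\in\{0,\frac12,1\}$ and $\epsilon_\nu\ge0$. The unknown is $$\mathbf u=(\alpha_1,\ \alpha_1\rho_1,\ \alpha_1\rho_1u_1,\ \alpha_1\rho_1E_1,\ \alpha_2\rho_2,\ \alpha_2\rho_2u_2,\ \alpha_2\rho_2E_2)^\top\in\mathbb R^7,\qquad \alpha_2=1-\alpha_1,$$ with void fractions $\alpha_i$, densities $\rho_i$, velocities $u_i$, specific total energies $E_i=e_i+u_i^2/2$. Pressure: $p_i=(\gamma_i-1)\rho_ie_i-\gamma_ip_{\infty,i}$. Temperature $T_i$ is defined by $\rho_ie_i=\rho_iC_{v,i}T_i+p_{\infty,i}$, $\theta_i=1/T_i$, sound speed $c_i=\sqrt{\gamma_i(\gamma_i-1)(\rho_ie_i-p_{\infty,i})/\rho_i}$. All nodal states at time $t^{(n)}$ are assumed to lie in the phase space $\Omega$: $0<\alpha_i<1$, $\rho_i>0$, $u_i\in\mathbb R$, $e_i>0$, $T_i>0$, $i=1,2$. Interface quantities: $u_I=\beta u_1+(1-\beta)u_2$, $p_I=\mu p_1+(1-\mu)p_2$, $\beta=\frac{\chi\alpha_1\rho_1}{\chi\alpha_1\rho_1+(1-\chi)\alpha_2\rho_2}$, $\mu=\frac{(1-\beta)T_2}{\beta T_1+(1-\beta)T_2}$. **Means and jumps.** For values $a^\pm$ at $\mathbf u^\pm$: $[\![a]\!]=a^+-a^-$, $\overline a=\frac{a^++a^-}2$,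 and for $a^\pm>0$ the logarithmic mean $\hat a=[\![a]\!]/[\![\ln a]\!]$ ($\hat a=a^-$ if $a^-=a^+$; the same convention applies to $\hat\rho_{i,j+1/2}$). **Fluxes.** A column $(a_i,b_i,c_i,d_i)^\top$, $i=1,2$, denotes $(a_1,b_1,c_1,d_1,b_2,c_2,d_2)^\top\in\mathbb R^7$ (void fraction, then mass, momentum, energy of each phase). Physical flux: $\mathbf f(\mathbf u)=(0,\alpha_i\rho_iu_i,\alpha_i(\rho_iu_i^2+p_i),\alpha_iu_i(\rho_iE_i+p_i))^\top$. Numerical fluxes: $$\mathbf h(\mathbf u^-,\mathbf u^+)=\begin{pmatrix}0\\ \overline\alpha_i\overline u_i\hat\rho_i\\ \overline\alpha_i\big(\overline u_i^2\hat\rho_i+\frac{\overline{p_i\theta_i}}{\overline\theta_i}\big)\\ \overline\alpha_i\overline u_i\big(\hat\rho_i\big(\frac{C_{v,i}}{\hat\theta_i}+\frac{u_i^-u_i^+}2\big)+\frac{\overline{p_i\theta_i}}{\overline\theta_i}+p_{\infty,i}\big)\end{pmatrix}-\beta_s\frac{[\![\alpha_i]\!]}2\begin{pmatrix}1\\ \hat\rho_i\\ \hat\rho_i\overline u_i\\ \hat\rho_i\big(\frac{C_{v,i}}{\hat\theta_i}+\frac{u_i^-u_i^+}2\big)+p_{\infty,i}\end{pmatrix},\quad \mathbf d^\pm(\mathbf u^-,\mathbf u^+)=\frac{[\![\alpha_i]\!]}2\begin{pmatrix}u_I^\pm\\0\\-p_I^\pm\\-p_I^\pm u_I^\pm\end{pmatrix},$$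 $$\mathbf D_\nu(\mathbf u^-,\mathbf u^+)=\frac{\epsilon_\nu}2\max\big(\rho_{\mathbf A}(\mathbf u^-),\rho_{\mathbf A}(\mathbf u^+)\big)\begin{pmatrix}0\\ [\![\rho_i]\!]\\ [\![\rho_iu_i]\!]\\ \big(\frac{C_{v,i}}{\hat\theta_i}+\frac{u_i^-u_i^+}2\big)[\![\rho_i]\!]+\overline\rho_i[\![E_i]\!]\end{pmatrix},\qquad\rho_{\mathbf A}(\mathbf u)=\max_{i=1,2}(|u_i|+c_i),$$ $$\mathbf D^-=\mathbf h(\mathbf u^-,\mathbf u^+)-\mathbf f(\mathbf u^-)+\mathbf d^-(\mathbf u^-,\mathbf u^+)-\mathbf D_\nu(\mathbf u^-,\mathbf u^+),\qquad \mathbf D^+=\mathbf f(\mathbf u^+)-\mathbf h(\mathbf u^-,\mathbf u^+)+\mathbf d^+(\mathbf u^-,\mathbf u^+)+\mathbf D_\nu(\mathbf u^-,\mathbf u^+),$$ $$\widetilde{\mathbf D}(\mathbf u^-,\mathbf u^+)=\mathbf h(\mathbf u^-,\mathbf u^+)+\mathbf h(\mathbf u^+,\mathbf u^-)+\mathbf d^-(\mathbf u^-,\mathbf u^+)-\mathbf d^+(\mathbf u^+,\mathbf u^-).$$ At the interface $x_{j+1/2}$ the value $\beta_s=\beta_{s_{j+1/2}}$ is used in $\mathbf h$ (the $\beta_s$ terms cancel in $\widetilde{\mathbf D}$). The interface dissipation coefficient is $\epsilon_{\nu_{j+1/2}}:=\frac{\epsilon_\nu}2\max\big(\rho_{\mathbf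 A}(\mathbf U^{p,n}_j),\rho_{\mathbf A}(\mathbf U^{0,n}_{j+1})\big)\ge0$. **DGSEM.** Uniform mesh of $\mathbb R$ with cells $\kappa_j$, $j\in\mathbb Z$, of length $h>0$ and centers $x_j$. For $p\ge1$, $-1=s_0<\dots<s_p=1$ are the Gauss–Lobatto nodes on $[-1,1]$, $\omega_k>0$ the weights ($\sum_k\omega_k=2$), $\ell_k$ the Lagrange polynomials at these nodes, $D_{kl}=\ell_l'(s_k)$, satisfying $\omega_kD_{kl}+\omega_lD_{lk}=\delta_{kp}\delta_{lp}-\delta_{k0}\delta_{l0}$ and $\sum_lD_{kl}=0$; $\phi^k_j(x)=\ell_k(2(x-x_j)/h)$, $x^k_j=x_j+s_kh/2$, and $\langle f,g\rangle^p_j=\frac h2\sum_{l=0}^p\omega_lf(x^l_j)g(x^l_j)$. Nodal states at time $t^{(n)}=n\Delta t$ are $\mathbf U^{k,n}_j$, with components $\alpha^{k,n}_{i,j},\rho^{k,n}_{i,j},u^{k,n}_{i,j}$, etc.; $u^{k,n}_{I,j}=u_I(\mathbf U^{k,n}_j)$, and $\langle u_{I,h}^{(n)},d_x\phi^k_j\rangle^p_j=\sum_{l=0}^p\omega_lD_{lk}u^{l,n}_{I,j}$. The fully discrete scheme is $$\frac{\omega_k}2(\mathbf U^{k,n+1}_j-\mathbf U^{k,n}_j)+\lambda\Big(\omega_k\sum_{l=0}^pD_{kl}\widetilde{\mathbf D}(\mathbf U^{k,n}_j,\mathbf U^{l,n}_j)+\delta_{kp}\mathbf D^-(\mathbf U^{p,n}_j,\mathbf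 U^{0,n}_{j+1})+\delta_{k0}\mathbf D^+(\mathbf U^{p,n}_{j-1},\mathbf U^{0,n}_j)\Big)=0.$$ Cell averages: $\langle\alpha_{i,h}\rangle^{(n)}_j=\frac12\sum_k\omega_k\alpha^{k,n}_{i,j}$ and $\langle\alpha_{i,h}\rho_{i,h}\rangle^{(n)}_j=\frac12\sum_k\omega_k\,(\alpha_i\rho_i)^{k,n}_j$, where $\alpha_1$ and $\alpha_i\rho_i$ are components of $\mathbf U^{k,n}_j$ and $\alpha_2=1-\alpha_1$. The maximum over $j\in\mathbb Z$ is understood as a supremum. *)

theory Defs
  imports "HOL-Analysis.Analysis" "HOL-Computational_Algebra.Polynomial"
begin

text \<open>
  The phases are the two elements \<open>1\<close>, \<open>2\<close> of the numeral type \<open>2\<close>.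
\<close>

record bn_model =
  heat_cap :: "2 \<Rightarrow> real"  \<comment> \<open>\<open>C\<^sub>v\<^sub>,\<^sub>i\<close>\<close>
  gam :: "2 \<Rightarrow> real"  \<comment> \<open>\<open>\<gamma>\<^sub>i\<close>\<close>
  pinf :: "2 \<Rightarrow> real"  \<comment> \<open>\<open>p\<^sub>\<infinity>\<^sub>,\<^sub>i\<close>\<close>
  chi :: real
  eps_nu :: real

definition bn_admissible :: "bn_model \<Rightarrow> bool" where
  "bn_admissible M \<longleftrightarrow>
     (\<forall>i. heat_cap M i > 0 \<and> gam M i > 1 \<and> pinf M i \<ge> 0) \<and>
     chi M \<in> {0, 1/2, 1} \<and> eps_nu M \<ge> 0"

text \<open>
  A state is the vector of conservative variables
  \<open>(\<alpha>\<^sub>1, \<alpha>\<^sub>1\<rho>\<^sub>1, \<alpha>\<^sub>1\<rho>\<^sub>1u\<^sub>1, \<alpha>\<^sub>1\<rho>\<^sub>1E\<^sub>1, \<alpha>\<^sub>2\<rho>\<^sub>2, \<alpha>\<^sub>2\<rho>\<^sub>2u\<^sub>2, \<alpha>\<^sub>2\<rho>\<^sub>2E\<^sub>2)\<close>; the other quantities are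
  functions of it.
\<close>

type_synonym state = "real^7"

definition void :: "2 \<Rightarrow> state \<Rightarrow> real" where  \<comment> \<open>\<open>\<alpha>\<^sub>i\<close>\<close>
  "void i u = (if i = 1 then u $ 1 else 1 - u $ 1)"

definition mass :: "2 \<Rightarrow> state \<Rightarrow> real" where  \<comment> \<open>\<open>\<alpha>\<^sub>i\<rho>\<^sub>i\<close>\<close>
  "mass i u = (if i = 1 then u $ 2 else u $ 5)"

definition momentum :: "2 \<Rightarrow> state \<Rightarrow> real" where  \<comment> \<open>\<open>\<alpha>\<^sub>i\<rho>\<^sub>iu\<^sub>i\<close>\<close>
  "momentum i u = (if i = 1 then u $ 3 else u $ 6)"

definition energy :: "2 \<Rightarrow> state \<Rightarrow> real" where  \<comment> \<open>\<open>\<alpha>\<^sub>i\<rho>\<^sub>iE\<^sub>i\<close>\<close>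
  "energy i u = (if i = 1 then u $ 4 else u $ 7)"

definition rho :: "2 \<Rightarrow> state \<Rightarrow> real" where
  "rho i u = mass i u / void i u"

definition vel :: "2 \<Rightarrow> state \<Rightarrow> real" where
  "vel i u = momentum i u / mass i u"

definition etot :: "2 \<Rightarrow> state \<Rightarrow> real" where  \<comment> \<open>\<open>E\<^sub>i\<close>\<close>
  "etot i u = energy i u / mass i u"

definition eint :: "2 \<Rightarrow> state \<Rightarrow> real" where  \<comment> \<open>\<open>e\<^sub>i\<close>, from \<open>E\<^sub>i = e\<^sub>i + u\<^sub>i\<^sup>2/2\<close>\<close>
  "eint i u = etot i u - (vel i u)\<^sup>2 / 2"

definition pres :: "bn_model \<Rightarrow> 2 \<Rightarrow> state \<Rightarrow> real" where
  "pres M i u = (gam M i - 1) * rho i u * eint i u - gam M i * pinf M i"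

definition temp :: "bn_model \<Rightarrow> 2 \<Rightarrow> state \<Rightarrow> real" where
    \<comment> \<open>the solution \<open>T\<^sub>i\<close> of \<open>\<rho>\<^sub>ie\<^sub>i = \<rho>\<^sub>iC\<^sub>v\<^sub>,\<^sub>iT\<^sub>i + p\<^sub>\<infinity>\<^sub>,\<^sub>i\<close>\<close>
  "temp M i u = (rho i u * eint i u - pinf M i) / (rho i u * heat_cap M i)"

definition theta :: "bn_model \<Rightarrow> 2 \<Rightarrow> state \<Rightarrow> real" where
  "theta M i u = 1 / temp M i u"

definition sound :: "bn_model \<Rightarrow> 2 \<Rightarrow> state \<Rightarrow> real" where
  "sound M i u =
     sqrt (gam M i * (gam M i - 1) * (rho i u * eint i u - pinf M i) / rho i u)"

definition phase_space :: "bn_model \<Rightarrow> state set" where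
  "phase_space M =
     {u. \<forall>i. 0 < void i u \<and> void i u < 1 \<and> rho i u > 0 \<and> eint i u > 0 \<and> temp M i u > 0}"

definition beta_I :: "bn_model \<Rightarrow> state \<Rightarrow> real" where
  "beta_I M u = chi M * (void 1 u * rho 1 u) /
     (chi M * (void 1 u * rho 1 u) + (1 - chi M) * (void 2 u * rho 2 u))"

definition mu_I :: "bn_model \<Rightarrow> state \<Rightarrow> real" where
  "mu_I M u = (1 - beta_I M u) * temp M 2 u /
     (beta_I M u * temp M 1 u + (1 - beta_I M u) * temp M 2 u)"

definition vel_I :: "bn_model \<Rightarrow> state \<Rightarrow> real" where
  "vel_I M u = beta_I M u * vel 1 u + (1 - beta_I M u) * vel 2 u"

definition pres_I :: "bn_model \<Rightarrow> state \<Rightarrow> real" where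
  "pres_I M u = mu_I M u * pres M 1 u + (1 - mu_I M u) * pres M 2 u"

definition rho_A :: "bn_model \<Rightarrow> state \<Rightarrow> real" where  \<comment> \<open>maximal wave speed \<open>\<rho>\<^sub>A\<close>\<close>
  "rho_A M u = (MAX i. \<bar>vel i u\<bar> + sound M i u)"

definition jump :: "('s \<Rightarrow> real) \<Rightarrow> 's \<Rightarrow> 's \<Rightarrow> real" where
  "jump a um up = a up - a um"

definition mean :: "('s \<Rightarrow> real) \<Rightarrow> 's \<Rightarrow> 's \<Rightarrow> real" where
  "mean a um up = (a um + a up) / 2"

definition logmean :: "('s \<Rightarrow> real) \<Rightarrow> 's \<Rightarrow> 's \<Rightarrow> real" where
  "logmean a um up =
     (if a um = a up then a um else jump a um up / jump (\<lambda>u. ln (a u)) um up)"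

definition column ::
    "(2 \<Rightarrow> real) \<Rightarrow> (2 \<Rightarrow> real) \<Rightarrow> (2 \<Rightarrow> real) \<Rightarrow> (2 \<Rightarrow> real) \<Rightarrow> state" where
  "column a b c d = vector [a 1, b 1, c 1, d 1, b 2, c 2, d 2]"

lemma column_nth:
  "column a b c d $ 1 = a 1"
  "column a b c d $ 2 = b 1" "column a b c d $ 3 = c 1" "column a b c d $ 4 = d 1"
  "column a b c d $ 5 = b 2" "column a b c d $ 6 = c 2" "column a b c d $ 7 = d 2"
  by (simp_all add: column_def vector_def)

definition phys_flux :: "bn_model \<Rightarrow> state \<Rightarrow> state" where
  "phys_flux M u = column
     (\<lambda>i. 0)
     (\<lambda>i. void i u * rho i u * vel i u)
     (\<lambda>i. void i u * (rho i u * (vel i u)\<^sup>2 + pres M i u))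
     (\<lambda>i. void i u * vel i u * (rho i u * etot i u + pres M i u))"

definition pres_mean :: "bn_model \<Rightarrow> 2 \<Rightarrow> state \<Rightarrow> state \<Rightarrow> real" where
  "pres_mean M i um up =
     mean (\<lambda>u. pres M i u * theta M i u) um up / mean (theta M i) um up"

definition ener_mean :: "bn_model \<Rightarrow> 2 \<Rightarrow> state \<Rightarrow> state \<Rightarrow> real" where
  "ener_mean M i um up =
     heat_cap M i / logmean (theta M i) um up + vel i um * vel i up / 2"

text \<open>In \<open>num_flux M b\<close> the scalar \<open>b\<close> is the coefficient \<open>\<beta>\<^sub>s\<close>.\<close>

definition num_flux :: "bn_model \<Rightarrow> real \<Rightarrow> state \<Rightarrow> state \<Rightarrow> state" where
  "num_flux M b um up =
     column
       (\<lambda>i. 0)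
       (\<lambda>i. mean (void i) um up * mean (vel i) um up * logmean (rho i) um up)
       (\<lambda>i. mean (void i) um up *
          ((mean (vel i) um up)\<^sup>2 * logmean (rho i) um up + pres_mean M i um up))
       (\<lambda>i. mean (void i) um up * mean (vel i) um up *
          (logmean (rho i) um up * ener_mean M i um up + pres_mean M i um up + pinf M i))
     - b *\<^sub>R column
       (\<lambda>i. jump (void i) um up / 2)
       (\<lambda>i. jump (void i) um up / 2 * logmean (rho i) um up)
       (\<lambda>i. jump (void i) um up / 2 * (logmean (rho i) um up * mean (vel i) um up))
       (\<lambda>i. jump (void i) um up / 2 *
          (logmean (rho i) um up * ener_mean M i um up + pinf M i))"

definition nc_flux :: "bn_model \<Rightarrow> state \<Rightarrow> state \<Rightarrow> state \<Rightarrow> state" where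
  "nc_flux M v um up = column
     (\<lambda>i. jump (void i) um up / 2 * vel_I M v)
     (\<lambda>i. 0)
     (\<lambda>i. jump (void i) um up / 2 * (- pres_I M v))
     (\<lambda>i. jump (void i) um up / 2 * (- pres_I M v * vel_I M v))"

definition nc_minus :: "bn_model \<Rightarrow> state \<Rightarrow> state \<Rightarrow> state" where  \<comment> \<open>\<open>d\<^sup>-\<close>\<close>
  "nc_minus M um up = nc_flux M um um up"

definition nc_plus :: "bn_model \<Rightarrow> state \<Rightarrow> state \<Rightarrow> state" where  \<comment> \<open>\<open>d\<^sup>+\<close>\<close>
  "nc_plus M um up = nc_flux M up um up"

definition visc_coeff :: "bn_model \<Rightarrow> state \<Rightarrow> state \<Rightarrow> real" where
  "visc_coeff M um up = eps_nu M / 2 * max (rho_A M um) (rho_A M up)"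

definition visc :: "bn_model \<Rightarrow> state \<Rightarrow> state \<Rightarrow> state" where  \<comment> \<open>\<open>D\<^sub>\<nu>\<close>\<close>
  "visc M um up = visc_coeff M um up *\<^sub>R column
     (\<lambda>i. 0)
     (\<lambda>i. jump (rho i) um up)
     (\<lambda>i. jump (\<lambda>u. rho i u * vel i u) um up)
     (\<lambda>i. ener_mean M i um up * jump (rho i) um up + mean (rho i) um up * jump (etot i) um up)"

definition fluct_minus :: "bn_model \<Rightarrow> real \<Rightarrow> state \<Rightarrow> state \<Rightarrow> state" where  \<comment> \<open>\<open>D\<^sup>-\<close>\<close>
  "fluct_minus M b um up =
     num_flux M b um up - phys_flux M um + nc_minus M um up - visc M um up"

definition fluct_plus :: "bn_model \<Rightarrow> real \<Rightarrow> state \<Rightarrow> state \<Rightarrow> state" where  \<comment> \<open>\<open>D\<^sup>+\<close>\<close>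
  "fluct_plus M b um up =
     phys_flux M up - num_flux M b um up + nc_plus M um up + visc M um up"

text \<open>
  The \<open>\<beta>\<^sub>s\<close> part of the numerical flux is antisymmetric, so the volume fluctuation below
  does not depend on the value of \<open>\<beta>\<^sub>s\<close>; it is written with \<open>\<beta>\<^sub>s = 0\<close>.
\<close>

lemma num_flux_swap:
  "num_flux M b um up + num_flux M b up um = num_flux M 0 um up + num_flux M 0 up um"
proof -
  have l: "logmean a up um = logmean a um up" for a :: "state \<Rightarrow> real"
    unfolding logmean_def jump_def
    by (metis minus_diff_eq minus_divide_left minus_divide_right minus_minus)
  have m: "mean a up um = mean a um up" for a :: "state \<Rightarrow> real"
    by (simp add: mean_def add.commute)
  have e: "ener_mean M i up um = ener_mean M i um up" for i
    by (simp add: ener_mean_def l mult.commute)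
  have j: "jump a up um = - jump a um up" for a :: "state \<Rightarrow> real"
    by (simp add: jump_def)
  have c: "column (\<lambda>i. - a i) (\<lambda>i. - b i) (\<lambda>i. - c i) (\<lambda>i. - d i) = - column a b c d"
    for a b c d
    by (simp add: column_def vector_def vec_eq_iff fun_upd_def)
  show ?thesis
    by (simp add: num_flux_def l m e j c)
qed

definition vol_fluct :: "bn_model \<Rightarrow> state \<Rightarrow> state \<Rightarrow> state" where  \<comment> \<open>\<open>D\<close> with a tilde\<close>
  "vol_fluct M um up =
     num_flux M 0 um up + num_flux M 0 up um + nc_minus M um up - nc_plus M up um"

text \<open>
  \<open>s\<close>, \<open>w\<close> are the nodes and weights of the \<open>(p + 1)\<close>-point Gauss--Lobatto quadrature rule
  on \<open>[-1, 1]\<close>: both end points are nodes and the rule is exact in degree \<open>\<le> 2p - 1\<close>.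
\<close>

definition gauss_lobatto :: "nat \<Rightarrow> (nat \<Rightarrow> real) \<Rightarrow> (nat \<Rightarrow> real) \<Rightarrow> bool" where
  "gauss_lobatto p s w \<longleftrightarrow>
     p \<ge> 1 \<and> s 0 = -1 \<and> s p = 1 \<and> strict_mono_on {..p} s \<and> (\<forall>k\<le>p. w k > 0) \<and>
     (\<forall>q :: real poly. degree q \<le> 2 * p - 1 \<longrightarrow>
        (\<Sum>k\<le>p. w k * poly q (s k)) = integral {-1..1} (poly q))"

definition lagrange_poly :: "nat \<Rightarrow> (nat \<Rightarrow> real) \<Rightarrow> nat \<Rightarrow> real poly" where
  "lagrange_poly p s k = (\<Prod>m\<in>{..p} - {k}. smult (1 / (s k - s m)) [:- s m, 1:])"

definition diff_mat :: "nat \<Rightarrow> (nat \<Rightarrow> real) \<Rightarrow> nat \<Rightarrow> nat \<Rightarrow> real" where  \<comment> \<open>\<open>D\<^sub>k\<^sub>l\<close>\<close>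
  "diff_mat p s k l = poly (pderiv (lagrange_poly p s l)) (s k)"

text \<open>
  \<open>U j k\<close> is the nodal state at node \<open>k \<le> p\<close> of cell \<open>j\<close>. A sequence over interfaces is indexed
  by the cell to the left: \<open>bs j\<close> is the value of \<open>\<beta>\<^sub>s\<close> at \<open>x\<^bsub>j+1/2\<^esub>\<close>.
\<close>

definition beta_loc :: "nat \<Rightarrow> (int \<Rightarrow> nat \<Rightarrow> state) \<Rightarrow> int \<Rightarrow> real" where
  "beta_loc p U j = (MAX i. max \<bar>vel i (U j p)\<bar> \<bar>vel i (U (j + 1) 0)\<bar>)"

definition dgsem_step ::
    "bn_model \<Rightarrow> nat \<Rightarrow> (nat \<Rightarrow> real) \<Rightarrow> (nat \<Rightarrow> real) \<Rightarrow> real \<Rightarrow> (int \<Rightarrow> real) \<Rightarrow>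
     (int \<Rightarrow> nat \<Rightarrow> state) \<Rightarrow> (int \<Rightarrow> nat \<Rightarrow> state) \<Rightarrow> bool" where
  "dgsem_step M p s w lam bs U U' \<longleftrightarrow> (\<forall>j. \<forall>k\<le>p.
     (w k / 2) *\<^sub>R (U' j k - U j k) +
     lam *\<^sub>R (w k *\<^sub>R (\<Sum>l\<le>p. diff_mat p s k l *\<^sub>R vol_fluct M (U j k) (U j l))
       + of_bool (k = p) *\<^sub>R fluct_minus M (bs j) (U j p) (U (j + 1) 0)
       + of_bool (k = 0) *\<^sub>R fluct_plus M (bs (j - 1)) (U (j - 1) p) (U j 0)) = 0)"

definition cell_avg ::
    "nat \<Rightarrow> (nat \<Rightarrow> real) \<Rightarrow> (state \<Rightarrow> real) \<Rightarrow> (int \<Rightarrow> nat \<Rightarrow> state) \<Rightarrow> int \<Rightarrow> real" where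
  "cell_avg p w a U j = (\<Sum>k\<le>p. w k * a (U j k)) / 2"

text \<open>
  The discrete product of the interface velocity with the derivative of the basis function
  \<open>\<phi>\<^sup>k\<^sub>j(x) = \<ell>\<^sub>k(2(x - x\<^sub>j)/h)\<close>: the factor \<open>h/2\<close> of the quadrature on the cell cancels the
  factor \<open>2/h\<close> of the derivative.
\<close>

definition vel_I_dphi ::
    "bn_model \<Rightarrow> nat \<Rightarrow> (nat \<Rightarrow> real) \<Rightarrow> (nat \<Rightarrow> real) \<Rightarrow> (int \<Rightarrow> nat \<Rightarrow> state) \<Rightarrow>
     int \<Rightarrow> nat \<Rightarrow> real" where
  "vel_I_dphi M p s w U j k = (\<Sum>l\<le>p. w l * diff_mat p s l k * vel_I M (U j l))"

definition void_rate ::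
    "bn_model \<Rightarrow> nat \<Rightarrow> (nat \<Rightarrow> real) \<Rightarrow> (nat \<Rightarrow> real) \<Rightarrow> (int \<Rightarrow> real) \<Rightarrow>
     (int \<Rightarrow> nat \<Rightarrow> state) \<Rightarrow> int \<Rightarrow> nat \<Rightarrow> real" where
  "void_rate M p s w bs U j k =
     vel_I_dphi M p s w U j k
     + of_bool (k = p) * ((bs j - vel_I M (U j p)) / 2)
     + of_bool (k = 0) * ((bs (j - 1) + vel_I M (U j 0)) / 2)"

definition mass_rate_left ::
    "bn_model \<Rightarrow> nat \<Rightarrow> (int \<Rightarrow> real) \<Rightarrow> (int \<Rightarrow> nat \<Rightarrow> state) \<Rightarrow> 2 \<Rightarrow> int \<Rightarrow> real" where
  "mass_rate_left M p bs U i j =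
     (let um = U (j - 1) p; up = U j 0 in
       (bs (j - 1) - mean (vel i) um up) * logmean (rho i) um up / (2 * rho i up)
       + visc_coeff M um up / void i up)"

definition mass_rate_right ::
    "bn_model \<Rightarrow> nat \<Rightarrow> (int \<Rightarrow> real) \<Rightarrow> (int \<Rightarrow> nat \<Rightarrow> state) \<Rightarrow> 2 \<Rightarrow> int \<Rightarrow> real" where
  "mass_rate_right M p bs U i j =
     (let um = U j p; up = U (j + 1) 0 in
       (bs j + mean (vel i) um up) * logmean (rho i) um up / (2 * rho i um)
       + visc_coeff M um up / void i um)"

definition cfl_rate ::
    "bn_model \<Rightarrow> nat \<Rightarrow> (nat \<Rightarrow> real) \<Rightarrow> (nat \<Rightarrow> real) \<Rightarrow> (int \<Rightarrow> real) \<Rightarrow>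
     (int \<Rightarrow> nat \<Rightarrow> state) \<Rightarrow> int \<Rightarrow> real" where
  "cfl_rate M p s w bs U j =
     (MAX i. max (MAX k\<in>{..p}. 1 / w k * void_rate M p s w bs U j k)
       (max (1 / w 0 * mass_rate_left M p bs U i j) (1 / w p * mass_rate_right M p bs U i j)))"

text \<open>
  The supremum over the cells is taken in \<^typ>\<open>ereal\<close>, so that the condition fails when the
  rates are unbounded above.
\<close>

definition cfl_condition ::
    "bn_model \<Rightarrow> nat \<Rightarrow> (nat \<Rightarrow> real) \<Rightarrow> (nat \<Rightarrow> real) \<Rightarrow> real \<Rightarrow> (int \<Rightarrow> real) \<Rightarrow>
     (int \<Rightarrow> nat \<Rightarrow> state) \<Rightarrow> bool" where
  "cfl_condition M p s w lam bs U \<longleftrightarrow>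
     ereal lam * (SUP j. ereal (cfl_rate M p s w bs U j)) < ereal (1 / 2)"

end

theory Submission
  imports Defs
begin

text \<open>
  In the void fraction equation the rows of the differentiation matrix sum to zero, so the volume
  terms of a cell collapse to \<open>\<Sum>\<^sub>k \<langle>u\<^sub>I, d\<^sub>x\<phi>\<^sup>k\<rangle> \<alpha>\<^sup>k\<close>; the update coefficients are nonnegative by the
  CFL condition and by \<open>\<bar>u\<^sub>I\<bar> \<le> \<beta>\<^sub>s\<close>, as \<open>u\<^sub>I\<close> is a convex combination of the two velocities. In the mass
  equations the volume fluctuation is twice a symmetric two-point flux, so summation by parts leaves
  only the interface fluxes. The part of such a flux that draws on the neighbouring cell has a
  favourable sign because \<open>\<bar>u\<^sub>i\<bar> \<le> \<beta>\<^sub>s\<close>, and the CFL condition bounds the remaining part by the mass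
  present at the end node.
\<close>

section \<open>Lagrange polynomials at the nodes and the row sums of the differentiation
  matrix\<close>

lemma degree_lagrange_poly:
  assumes "k \<le> p"
  shows "degree (lagrange_poly p s k) \<le> p"
proof -
  have "degree (lagrange_poly p s k)
      \<le> (\<Sum>m\<in>{..p} - {k}. degree (smult (1 / (s k - s m)) [:- s m, 1:]))"
    unfolding lagrange_poly_def
    using degree_prod_sum_le[of "{..p} - {k}" "\<lambda>m. smult (1 / (s k - s m)) [:- s m, 1:]"]
    by (simp add: o_def)
  also have "\<dots> \<le> (\<Sum>m\<in>{..p} - {k}. 1)"
    by (rule sum_mono) simp
  finally show ?thesis using assms by simp
qed

lemma poly_lagrange_poly:
  assumes "inj_on s {..p}" "k \<le> p" "m \<le> p"
  shows "poly (lagrange_poly p s k) (s m) = of_bool (k = m)"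
proof (cases "k = m")
  case True
  have "s m - s l \<noteq> 0" if "l \<in> {..p} - {m}" for l
    using that assms by (auto simp: inj_on_def)
  then show ?thesis
    using True by (simp add: lagrange_poly_def poly_prod flip: diff_divide_distrib)
next
  case False
  then have "m \<in> {..p} - {k}" using assms by simp
  then have "(\<Prod>l\<in>{..p} - {k}. poly (smult (1 / (s k - s l)) [:- s l, 1:]) (s m)) = 0"
    by (intro prod_zero) (auto intro!: bexI[of _ m])
  then show ?thesis
    using False by (simp add: lagrange_poly_def poly_prod)
qed

text \<open>Both sides have degree at most \<open>p\<close> and take the value 1 at
  \<open>p + 1\<close> distinct nodes.\<close>

lemma sum_lagrange_poly:
  assumes "inj_on s {..p}"
  shows "(\<Sum>k\<le>p. lagrange_poly p s k) = 1"
proof (rule poly_eqI_degree[where A = "s ` {..p}"])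
  fix x assume "x \<in> s ` {..p}"
  then obtain m where m: "m \<le> p" "x = s m" by auto
  have "(\<Sum>k\<le>p. poly (lagrange_poly p s k) (s m)) = (\<Sum>k\<le>p. of_bool (k = m))"
    using m by (intro sum.cong) (auto simp: poly_lagrange_poly assms)
  also have "\<dots> = 1" using m by (simp add: of_bool_def)
  finally show "poly (\<Sum>k\<le>p. lagrange_poly p s k) x = poly 1 x"
    using m by (simp add: poly_sum)
next
  have "degree (\<Sum>k\<le>p. lagrange_poly p s k) \<le> p"
    by (rule degree_sum_le) (auto intro: degree_lagrange_poly)
  then show "degree (\<Sum>k\<le>p. lagrange_poly p s k) < card (s ` {..p})"
    using assms by (simp add: card_image)
qed (use assms in \<open>simp add: card_image\<close>)

text \<open>The row sum is the derivative of the constant 1 at a node. Hence a constant nodal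
  function contributes nothing to the volume terms.\<close>

lemma sum_diff_mat:
  assumes "inj_on s {..p}"
  shows "(\<Sum>l\<le>p. diff_mat p s k l) = 0"
proof -
  have "(\<Sum>l\<le>p. diff_mat p s k l) = poly (pderiv (\<Sum>l\<le>p. lagrange_poly p s l)) (s k)"
    by (simp add: diff_mat_def poly_sum higher_pderiv_sum[of 1, simplified])
  then show ?thesis
    by (simp add: sum_lagrange_poly assms pderiv_1)
qed

section \<open>Gauss-Lobatto quadrature and summation by parts\<close>

lemma gauss_lobatto_inj_on:
  "gauss_lobatto p s w \<Longrightarrow> inj_on s {..p}"
  unfolding gauss_lobatto_def by (blast intro: strict_mono_on_imp_inj_on)

lemma gauss_lobatto_sum_weights:
  assumes "gauss_lobatto p s w"
  shows "(\<Sum>k\<le>p. w k) = 2"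
proof -
  have "(\<Sum>k\<le>p. w k * poly 1 (s k)) = integral {-1..1} (poly 1)"
    using assms unfolding gauss_lobatto_def by (metis degree_1 zero_le)
  then show ?thesis
    by (simp add: poly_1[abs_def])
qed

text \<open>
  The product of two Lagrange polynomials has a derivative of degree at most \<open>2p - 1\<close>, which
  the quadrature integrates exactly.
\<close>

lemma summation_by_parts:
  assumes gl: "gauss_lobatto p s w" and k: "k \<le> p" and l: "l \<le> p"
  shows "w k * diff_mat p s k l + w l * diff_mat p s l k
    = of_bool (k = p \<and> l = p) - of_bool (k = 0 \<and> l = 0)"
proof -
  note inj = gauss_lobatto_inj_on[OF gl]
  note at_node = poly_lagrange_poly[OF inj]
  have ends: "s 0 = -1" "s p = 1"
    using gl by (auto simp: gauss_lobatto_def)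
  let ?L = "lagrange_poly p s"
  let ?q = "?L k * ?L l"
  have "degree ?q \<le> 2 * p"
    using degree_mult_le[of "?L k" "?L l"] degree_lagrange_poly[OF k, of s]
      degree_lagrange_poly[OF l, of s] by linarith
  then have "degree (pderiv ?q) \<le> 2 * p - 1"
    by (simp add: degree_pderiv)
  then have "(\<Sum>m\<le>p. w m * poly (pderiv ?q) (s m)) = integral {-1..1} (poly (pderiv ?q))"
    using gl by (simp add: gauss_lobatto_def)
  also have "(poly (pderiv ?q) has_integral poly ?q 1 - poly ?q (-1)) {-1..1}"
    by (rule fundamental_theorem_of_calculus)
      (auto simp del: poly_mult simp flip: has_real_derivative_iff_has_vector_derivative
        intro: DERIV_subset[OF poly_DERIV])
  then have "integral {-1..1} (poly (pderiv ?q)) = poly ?q (s p) - poly ?q (s 0)"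
    using ends by (simp add: integral_unique)
  also have "\<dots> = of_bool (k = p \<and> l = p) - of_bool (k = 0 \<and> l = 0)"
    by (simp only: poly_mult at_node[OF k] at_node[OF l] order.refl le0) auto
  \<comment> \<open>Product rule: each undifferentiated factor is 0 or 1 at the nodes, so each of
    the two terms survives at a single node, \<open>m = k\<close> or \<open>m = l\<close>.\<close>
  also have "(\<Sum>m\<le>p. w m * poly (pderiv ?q) (s m)) =
      (\<Sum>m\<le>p. if k = m then w m * diff_mat p s m l else 0) +
      (\<Sum>m\<le>p. if l = m then w m * diff_mat p s m k else 0)"
    unfolding sum.distrib[symmetric]
    by (rule sum.cong)
      (auto simp: pderiv_mult at_node k l diff_mat_def algebra_simps)
  also have "\<dots> = w k * diff_mat p s k l + w l * diff_mat p s l k"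
    using k l by simp
  finally show ?thesis .
qed

text \<open>The factor 2 gives two copies of the double sum. Exchanging the indices in one copy,
  which the symmetry of \<open>H\<close> permits, produces \<open>w k * D k l + w l * D l k\<close>,
  and this vanishes except at the two corner entries.\<close>

lemma sum_by_parts_symmetric:
  assumes gl: "gauss_lobatto p s w" and sym: "\<And>k l. H k l = H l k"
  shows "(\<Sum>k\<le>p. w k * (\<Sum>l\<le>p. diff_mat p s k l * (2 * H k l))) = H p p - H 0 0"
proof -
  let ?D = "diff_mat p s"
  have swap: "(\<Sum>k\<le>p. \<Sum>l\<le>p. w k * ?D k l * H k l) = (\<Sum>k\<le>p. \<Sum>l\<le>p. w l * ?D l k * H k l)"
    by (subst sum.swap) (simp only: sym)
  have "(\<Sum>k\<le>p. w k * (\<Sum>l\<le>p. ?D k l * (2 * H k l))) =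
      (\<Sum>k\<le>p. \<Sum>l\<le>p. w k * ?D k l * H k l) + (\<Sum>k\<le>p. \<Sum>l\<le>p. w k * ?D k l * H k l)"
    by (simp only: sum_distrib_left mult_2 distrib_left mult.assoc sum.distrib)
  also have "\<dots> = (\<Sum>k\<le>p. \<Sum>l\<le>p. w k * ?D k l * H k l) + (\<Sum>k\<le>p. \<Sum>l\<le>p. w l * ?D l k * H k l)"
    by (simp only: swap)
  also have "\<dots> = (\<Sum>k\<le>p. \<Sum>l\<le>p. (w k * ?D k l + w l * ?D l k) * H k l)"
    by (simp only: distrib_right sum.distrib)
  also have "\<dots> = (\<Sum>k\<le>p. \<Sum>l\<le>p. (if k = p then if l = p then H k l else 0 else 0)
      - (if k = 0 then if l = 0 then H k l else 0 else 0))"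
  proof (intro sum.cong refl)
    fix k l assume "k \<in> {..p}" "l \<in> {..p}"
    then show "(w k * ?D k l + w l * ?D l k) * H k l =
        (if k = p then if l = p then H k l else 0 else 0)
        - (if k = 0 then if l = 0 then H k l else 0 else 0)"
      using summation_by_parts[OF gl, of k l] by (simp only: atMost_iff) simp
  qed
  also have "\<dots> = (\<Sum>k\<le>p. (if k = p then H k p else 0) - (if k = 0 then H k 0 else 0))"
    by (intro sum.cong refl) (simp add: sum_subtractf)
  also have "\<dots> = H p p - H 0 0"
    by (simp add: sum_subtractf)
  finally show ?thesis .
qed

section \<open>Void fraction and mass components of the fluxes and of the scheme\<close>

lemma linear_mass: "linear (mass i)"
  by (rule linearI) (auto simp: mass_def)

lemma mass_column: "mass i (column a b c d) = b i"
  using exhaust_2[of i] by (auto simp: mass_def column_nth)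

lemma void_1: "void 1 u = u $ 1"
  by (simp add: void_def)

lemma void_2: "void 2 u = 1 - void 1 u"
  by (simp add: void_def)

lemma mass_eq: "void i u \<noteq> 0 \<Longrightarrow> mass i u = void i u * rho i u"
  by (simp add: rho_def)

lemma logmean_self: "logmean a u u = a u"
  by (simp add: logmean_def)

lemma logmean_commute: "logmean a um up = logmean a up um"
  unfolding logmean_def jump_def
  by (metis minus_diff_eq minus_divide_left minus_divide_right minus_minus)

lemma mean_commute: "mean a um up = mean a up um"
  by (simp add: mean_def add.commute)

text \<open>The logarithm is increasing, so the two jumps in the quotient have the same
  sign.\<close>

lemma logmean_pos:
  assumes "a um > 0" "a up > 0"
  shows "logmean a um up > 0"
proof (cases "a um" "a up" rule: linorder_cases)
  case less
  then show ?thesis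
    using assms by (simp add: logmean_def jump_def)
next
  case greater
  then show ?thesis
    using assms by (simp add: logmean_def jump_def divide_neg_neg)
qed (use assms in \<open>simp add: logmean_def\<close>)

text \<open>The part of the numerical mass flux free of the \<open>bs\<close> term. It is symmetric,
  as summation by parts requires, and it reduces to the physical mass flux at equal states.\<close>

definition mass_flux :: "2 \<Rightarrow> state \<Rightarrow> state \<Rightarrow> real" where
  "mass_flux i um up = mean (void i) um up * mean (vel i) um up * logmean (rho i) um up"

lemma mass_flux_commute: "mass_flux i um up = mass_flux i up um"
  by (simp add: mass_flux_def mean_commute logmean_commute)

lemma mass_flux_self: "mass_flux i u u = void i u * rho i u * vel i u"
  by (simp add: mass_flux_def mean_def logmean_self)

lemmas mass_linear =
  linear_add[OF linear_mass] linear_diff[OF linear_mass] linear_scale[OF linear_mass]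

lemma mass_num_flux:
  "mass i (num_flux M b um up) =
    mass_flux i um up - b * (jump (void i) um up / 2 * logmean (rho i) um up)"
  by (simp add: num_flux_def mass_linear mass_column mass_flux_def)

lemma mass_vol_fluct: "mass i (vol_fluct M um up) = 2 * mass_flux i um up"
  by (simp add: vol_fluct_def nc_minus_def nc_plus_def nc_flux_def mass_linear mass_column
      mass_num_flux mass_flux_commute[of i up um])

lemma mass_fluct_minus:
  "mass i (fluct_minus M b um up) =
    mass i (num_flux M b um up) - mass_flux i um um - visc_coeff M um up * jump (rho i) um up"
  by (simp add: fluct_minus_def nc_minus_def nc_flux_def visc_def phys_flux_def mass_linear
      mass_column mass_flux_self)

lemma mass_fluct_plus:
  "mass i (fluct_plus M b um up) =
    mass_flux i up up - mass i (num_flux M b um up) + visc_coeff M um up * jump (rho i) um up"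
  by (simp add: fluct_plus_def nc_plus_def nc_flux_def visc_def phys_flux_def mass_linear
      mass_column mass_flux_self)

text \<open>Both nonconservative terms evaluate the interface velocity at \<open>um\<close>. Their
  half jumps have opposite orientation and are subtracted, so they add up to one full jump.\<close>

lemma void_vol_fluct:
  "vol_fluct M um up $ 1 = vel_I M um * (void 1 up - void 1 um)"
  by (simp add: vol_fluct_def nc_minus_def nc_plus_def nc_flux_def num_flux_def column_nth
      jump_def field_simps)

lemma void_fluct_minus:
  "fluct_minus M b um up $ 1 = - ((b - vel_I M um) / 2) * (void 1 up - void 1 um)"
  by (simp add: fluct_minus_def phys_flux_def visc_def nc_minus_def nc_flux_def num_flux_def
      column_nth jump_def field_simps)

lemma void_fluct_plus:
  "fluct_plus M b um up $ 1 = (b + vel_I M up) / 2 * (void 1 up - void 1 um)"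
  by (simp add: fluct_plus_def phys_flux_def visc_def nc_plus_def nc_flux_def num_flux_def
      column_nth jump_def field_simps)

text \<open>The scheme is summed over the nodes of one cell; each Kronecker factor selects one end
  node. An arbitrary linear \<open>L\<close> lets one identity serve both the first component and
  the partial masses.\<close>

lemma dgsem_cell_avg:
  assumes "dgsem_step M p s w lam bs U U'" and lin: "linear L"
  shows "cell_avg p w L U' j = cell_avg p w L U j - lam *
    ((\<Sum>k\<le>p. w k * (\<Sum>l\<le>p. diff_mat p s k l * L (vol_fluct M (U j k) (U j l))))
      + L (fluct_minus M (bs j) (U j p) (U (j + 1) 0))
      + L (fluct_plus M (bs (j - 1)) (U (j - 1) p) (U j 0)))"
proof -
  let ?V = "\<lambda>k. w k * (\<Sum>l\<le>p. diff_mat p s k l * L (vol_fluct M (U j k) (U j l)))"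
  let ?m = "L (fluct_minus M (bs j) (U j p) (U (j + 1) 0))"
  let ?q = "L (fluct_plus M (bs (j - 1)) (U (j - 1) p) (U j 0))"
  have "w k / 2 * (L (U' j k) - L (U j k)) +
      lam * (?V k + of_bool (k = p) * ?m + of_bool (k = 0) * ?q) = 0" if "k \<le> p" for k
  proof -
    have "(w k / 2) *\<^sub>R (U' j k - U j k) +
       lam *\<^sub>R (w k *\<^sub>R (\<Sum>l\<le>p. diff_mat p s k l *\<^sub>R vol_fluct M (U j k) (U j l))
       + of_bool (k = p) *\<^sub>R fluct_minus M (bs j) (U j p) (U (j + 1) 0)
       + of_bool (k = 0) *\<^sub>R fluct_plus M (bs (j - 1)) (U (j - 1) p) (U j 0)) = 0"
      using assms(1) that by (simp only: dgsem_step_def)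
    from arg_cong[OF this, of L] show ?thesis
      by (simp only: linear_add[OF lin] linear_diff[OF lin] linear_scale[OF lin]
          linear_sum[OF lin] linear_0[OF lin] real_scaleR_def)
  qed
  then have "0 = (\<Sum>k\<le>p. w k / 2 * (L (U' j k) - L (U j k)) +
      lam * (?V k + of_bool (k = p) * ?m + of_bool (k = 0) * ?q))"
    by simp
  also have "\<dots> = cell_avg p w L U' j - cell_avg p w L U j + lam * ((\<Sum>k\<le>p. ?V k)
      + (\<Sum>k\<le>p. of_bool (k = p) * ?m) + (\<Sum>k\<le>p. of_bool (k = 0) * ?q))"
    by (simp add: cell_avg_def sum.distrib sum_subtractf right_diff_distrib
        flip: sum_distrib_left sum_divide_distrib)
  also have "(\<Sum>k\<le>p. of_bool (k = p) * ?m) = ?m"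
    by (simp add: of_bool_def if_distrib[of "\<lambda>x. x * _"] cong: if_cong)
  also have "(\<Sum>k\<le>p. of_bool (k = 0) * ?q) = ?q"
    by (simp add: of_bool_def if_distrib[of "\<lambda>x. x * _"] cong: if_cong)
  finally show ?thesis by linarith
qed

section \<open>Bounds on the interface velocity and the viscosity, and consequences of the CFL
  condition\<close>

text \<open>Because \<open>chi\<close> lies between 0 and 1 and both partial masses are positive,
  the weight \<open>beta_I\<close> lies in the unit interval.\<close>

lemma abs_vel_I_le:
  assumes M: "bn_admissible M" and u: "u \<in> phase_space M" and b: "\<And>i. \<bar>vel i u\<bar> \<le> b"
  shows "\<bar>vel_I M u\<bar> \<le> b"
proof -
  have pos: "void i u * rho i u > 0" for i
    using u by (auto simp: phase_space_def)
  define x where "x = chi M * (void 1 u * rho 1 u)"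
  define y where "y = (1 - chi M) * (void 2 u * rho 2 u)"
  have xy: "x \<ge> 0" "y \<ge> 0"
    using M pos[of 1] pos[of 2] by (auto simp: x_def y_def bn_admissible_def)
  have "beta_I M u = x / (x + y)"
    by (simp add: beta_I_def x_def y_def)
  then have t: "0 \<le> beta_I M u" "beta_I M u \<le> 1"
    using xy by (auto simp: divide_le_eq_1)
  have "\<bar>vel_I M u\<bar> \<le> beta_I M u * \<bar>vel 1 u\<bar> + (1 - beta_I M u) * \<bar>vel 2 u\<bar>"
    unfolding vel_I_def using t by (intro order.trans[OF abs_triangle_ineq]) (simp add: abs_mult)
  also have "\<dots> \<le> b"
    using t b by (intro convex_bound_le) auto
  finally show ?thesis .
qed

lemma visc_coeff_nonneg:
  assumes M: "bn_admissible M" and u: "um \<in> phase_space M"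
  shows "visc_coeff M um up \<ge> 0"
proof -
  have g: "gam M 1 > 1" "heat_cap M 1 > 0" and e: "eps_nu M \<ge> 0"
    using M by (auto simp: bn_admissible_def)
  have r: "rho 1 um > 0" and T: "temp M 1 um > 0"
    using u by (auto simp: phase_space_def)
  \<comment> \<open>In HOL \<open>sqrt\<close> is negative on negative arguments, so the sign of the
    radicand matters; a positive temperature makes it positive.\<close>
  have "rho 1 um * eint 1 um - pinf M 1 = temp M 1 um * (rho 1 um * heat_cap M 1)"
    using r g by (simp add: temp_def)
  then have "rho 1 um * eint 1 um - pinf M 1 > 0"
    using r g T by simp
  then have "sound M 1 um \<ge> 0"
    using g r by (simp add: sound_def)
  then have "0 \<le> \<bar>vel 1 um\<bar> + sound M 1 um" by simp
  also have "\<dots> \<le> rho_A M um"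
    unfolding rho_A_def by (rule Max_ge) auto
  finally show ?thesis
    using e by (simp add: visc_coeff_def le_max_iff_disj)
qed

lemma abs_vel_le_beta_loc:
  "\<bar>vel i (U j p)\<bar> \<le> beta_loc p U j" "\<bar>vel i (U (j + 1) 0)\<bar> \<le> beta_loc p U j"
proof -
  have "max \<bar>vel i (U j p)\<bar> \<bar>vel i (U (j + 1) 0)\<bar> \<le> beta_loc p U j"
    unfolding beta_loc_def by (rule Max_ge) auto
  then show "\<bar>vel i (U j p)\<bar> \<le> beta_loc p U j" "\<bar>vel i (U (j + 1) 0)\<bar> \<le> beta_loc p U j"
    by auto
qed

text \<open>The comparison with the supremum takes place in \<open>ereal\<close>, where the supremum
  is an upper bound even for an unbounded family; only the outcome for a single cell returns to the
  reals.\<close>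

lemma cfl_rate_less:
  assumes "cfl_condition M p s w lam bs U" "lam > 0"
  shows "lam * cfl_rate M p s w bs U j < 1 / 2"
proof -
  have "ereal lam * ereal (cfl_rate M p s w bs U j)
      \<le> ereal lam * (SUP j. ereal (cfl_rate M p s w bs U j))"
    using assms(2) by (intro ereal_mult_left_mono SUP_upper) auto
  also have "\<dots> < ereal (1 / 2)"
    using assms(1) by (simp add: cfl_condition_def)
  finally show ?thesis by simp
qed

lemma cfl_rates_less:
  assumes cfl: "cfl_condition M p s w lam bs U" and lam: "lam > 0"
    and w: "\<And>k. k \<le> p \<Longrightarrow> w k > 0"
  shows "k \<le> p \<Longrightarrow> lam * void_rate M p s w bs U j k < w k / 2"
    and "lam * mass_rate_left M p bs U i j < w 0 / 2"
    and "lam * mass_rate_right M p bs U i j < w p / 2"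
proof -
  let ?r = "max (MAX k\<in>{..p}. 1 / w k * void_rate M p s w bs U j k)
    (max (1 / w 0 * mass_rate_left M p bs U i j) (1 / w p * mass_rate_right M p bs U i j))"
  have "?r \<le> cfl_rate M p s w bs U j"
    unfolding cfl_rate_def by (rule Max_ge) auto
  then have "lam * ?r \<le> lam * cfl_rate M p s w bs U j"
    using lam by simp
  then have r: "lam * ?r < 1 / 2"
    using cfl_rate_less[OF cfl lam, of j] by linarith
  \<comment> \<open>Any entry of the nested maximum can be extracted in the same way, since its
    weight \<open>w k\<close> is positive.\<close>
  have *: "lam * x < w k / 2" if "1 / w k * x \<le> ?r" "k \<le> p" for x k
  proof -
    have "lam * (1 / w k * x) \<le> lam * ?r"
      using that lam by (intro mult_left_mono) auto
    from le_less_trans[OF this r] show ?thesis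
      using w[OF that(2)] by (simp add: field_simps)
  qed
  show "lam * mass_rate_left M p bs U i j < w 0 / 2"
    by (rule *) auto
  show "lam * mass_rate_right M p bs U i j < w p / 2"
    by (rule *) auto
  show "lam * void_rate M p s w bs U j k < w k / 2" if "k \<le> p"
    using that by (intro *) (auto simp: le_max_iff_disj intro!: disjI1 Max_ge)
qed

section \<open>Update formulas for the cell averages\<close>

text \<open>Exchanging the sums transposes the differentiation matrix and so moves the derivative
  from the basis functions to \<open>a\<close>. Two choices of \<open>a\<close> are used: the
  constant 1 for the sum of the coefficients, and the void fraction for the update itself.\<close>

lemma sum_void_rate_mult:
  "(\<Sum>k\<le>p. void_rate M p s w bs U j k * a k) =
    (\<Sum>k\<le>p. w k * vel_I M (U j k) * (\<Sum>l\<le>p. diff_mat p s k l * a l))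
    + (bs j - vel_I M (U j p)) / 2 * a p + (bs (j - 1) + vel_I M (U j 0)) / 2 * a 0"
proof -
  have "(\<Sum>k\<le>p. vel_I_dphi M p s w U j k * a k) =
      (\<Sum>k\<le>p. \<Sum>l\<le>p. w l * diff_mat p s l k * vel_I M (U j l) * a k)"
    by (simp add: vel_I_dphi_def sum_distrib_right)
  also have "\<dots> = (\<Sum>l\<le>p. \<Sum>k\<le>p. w l * diff_mat p s l k * vel_I M (U j l) * a k)"
    by (rule sum.swap)
  also have "\<dots> = (\<Sum>k\<le>p. w k * vel_I M (U j k) * (\<Sum>l\<le>p. diff_mat p s k l * a l))"
    by (simp add: sum_distrib_left mult_ac)
  finally have "(\<Sum>k\<le>p. vel_I_dphi M p s w U j k * a k) = \<dots>" .
  moreover have "(\<Sum>k\<le>p. of_bool (k = m) * c * a k) = c * a m" if "m \<le> p" for c m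
    using that by (simp add: of_bool_def if_distrib[of "\<lambda>x. x * _"] cong: if_cong)
  ultimately show ?thesis
    by (simp only: void_rate_def distrib_right sum.distrib le0 order.refl)
qed

context
  fixes M :: bn_model and p :: nat and s w :: "nat \<Rightarrow> real" and lam :: real
    and U U' :: "int \<Rightarrow> nat \<Rightarrow> state" and bs :: "int \<Rightarrow> real"
  assumes quadrature: "gauss_lobatto p s w"
    and scheme: "dgsem_step M p s w lam bs U U'"
begin

text \<open>With \<open>a = 1\<close> the volume part vanishes, so the rates sum to exactly what the
  two neighbour coefficients restore. The halved weights supply the remaining 1.\<close>

lemma void_update_coeffs_sum:
  "(\<Sum>k\<le>p. w k / 2 - lam * void_rate M p s w bs U j k)
    + lam * ((bs j - vel_I M (U j p)) / 2) + lam * ((bs (j - 1) + vel_I M (U j 0)) / 2) = 1"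
proof -
  have "(\<Sum>k\<le>p. void_rate M p s w bs U j k) =
      (bs j - vel_I M (U j p)) / 2 + (bs (j - 1) + vel_I M (U j 0)) / 2"
    using sum_void_rate_mult[of M p s w bs U j "\<lambda>_. 1"]
    by (simp add: sum_diff_mat gauss_lobatto_inj_on[OF quadrature])
  then show ?thesis
    using gauss_lobatto_sum_weights[OF quadrature]
    by (simp add: sum_subtractf algebra_simps flip: sum_distrib_left sum_divide_distrib)
qed

lemma void_update:
  "cell_avg p w (void i) U' j =
    (\<Sum>k\<le>p. (w k / 2 - lam * void_rate M p s w bs U j k) * void i (U j k))
    + lam * ((bs j - vel_I M (U j p)) / 2) * void i (U (j + 1) 0)
    + lam * ((bs (j - 1) + vel_I M (U j 0)) / 2) * void i (U (j - 1) p)"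
proof -
  let ?D = "diff_mat p s"
  let ?c = "\<lambda>k. w k / 2 - lam * void_rate M p s w bs U j k"
  let ?R = "lam * ((bs j - vel_I M (U j p)) / 2)"
  let ?L = "lam * ((bs (j - 1) + vel_I M (U j 0)) / 2)"
  have lin: "linear (\<lambda>u :: state. u $ 1)"
    by (rule linearI) auto
  \<comment> \<open>In the jump, the value at node \<open>k\<close> is multiplied by a zero row sum
    and drops out.\<close>
  have "(\<Sum>l\<le>p. ?D k l * (vol_fluct M (U j k) (U j l) $ 1)) =
      vel_I M (U j k) * (\<Sum>l\<le>p. ?D k l * void 1 (U j l))" for k
  proof -
    have "(\<Sum>l\<le>p. ?D k l * (vol_fluct M (U j k) (U j l) $ 1)) =
        vel_I M (U j k) * ((\<Sum>l\<le>p. ?D k l * void 1 (U j l)) - (\<Sum>l\<le>p. ?D k l) * void 1 (U j k))"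
      by (simp add: void_vol_fluct sum_distrib_left sum_distrib_right sum_subtractf algebra_simps)
    then show ?thesis
      by (simp add: sum_diff_mat gauss_lobatto_inj_on[OF quadrature])
  qed
  then have "cell_avg p w (void 1) U' j = cell_avg p w (void 1) U j - lam *
      ((\<Sum>k\<le>p. w k * vel_I M (U j k) * (\<Sum>l\<le>p. ?D k l * void 1 (U j l)))
        + - ((bs j - vel_I M (U j p)) / 2) * (void 1 (U (j + 1) 0) - void 1 (U j p))
        + (bs (j - 1) + vel_I M (U j 0)) / 2 * (void 1 (U j 0) - void 1 (U (j - 1) p)))"
    using dgsem_cell_avg[OF scheme lin, of j]
    by (simp only: void_fluct_minus void_fluct_plus void_1[abs_def] mult.assoc)
  moreover have "(\<Sum>k\<le>p. ?c k * void 1 (U j k)) =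
      cell_avg p w (void 1) U j - lam * (\<Sum>k\<le>p. void_rate M p s w bs U j k * void 1 (U j k))"
    by (simp add: cell_avg_def left_diff_distrib sum_subtractf sum_distrib_left sum_divide_distrib
        mult.assoc)
  ultimately have one: "cell_avg p w (void 1) U' j =
      (\<Sum>k\<le>p. ?c k * void 1 (U j k)) + ?R * void 1 (U (j + 1) 0) + ?L * void 1 (U (j - 1) p)"
    unfolding sum_void_rate_mult by (simp add: field_simps)
  \<comment> \<open>The second void fraction is affine, not linear, in the state. The complement
    passes to the averages because the weights sum to 2, and to the right-hand side because the
    coefficients sum to 1.\<close>
  have "cell_avg p w (void 2) U' j = 1 - cell_avg p w (void 1) U' j"
    using gauss_lobatto_sum_weights[OF quadrature]
    by (simp add: cell_avg_def void_2 right_diff_distrib sum_subtractf diff_divide_distrib)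
  also have "\<dots> = (\<Sum>k\<le>p. ?c k) - (\<Sum>k\<le>p. ?c k * void 1 (U j k))
      + ?R * void 2 (U (j + 1) 0) + ?L * void 2 (U (j - 1) p)"
    unfolding one void_update_coeffs_sum[of j, symmetric] by (simp only: void_2) algebra
  also have "(\<Sum>k\<le>p. ?c k) - (\<Sum>k\<le>p. ?c k * void 1 (U j k)) = (\<Sum>k\<le>p. ?c k * void 2 (U j k))"
    by (simp only: void_2 right_diff_distrib sum_subtractf mult_1_right)
  finally show ?thesis
    using one exhaust_2[of i] by auto
qed

text \<open>Summation by parts leaves the physical mass fluxes at the two end nodes. These cancel
  against the ones contained in \<open>fluct_minus\<close> and \<open>fluct_plus\<close>, so the
  update is conservative.\<close>

lemma mass_update:
  "cell_avg p w (mass i) U' j = cell_avg p w (mass i) U j - lam *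
    ((mass i (num_flux M (bs j) (U j p) (U (j + 1) 0))
        - visc_coeff M (U j p) (U (j + 1) 0) * jump (rho i) (U j p) (U (j + 1) 0))
      - (mass i (num_flux M (bs (j - 1)) (U (j - 1) p) (U j 0))
        - visc_coeff M (U (j - 1) p) (U j 0) * jump (rho i) (U (j - 1) p) (U j 0)))"
proof -
  have "(\<Sum>k\<le>p. w k * (\<Sum>l\<le>p. diff_mat p s k l * mass i (vol_fluct M (U j k) (U j l)))) =
      mass_flux i (U j p) (U j p) - mass_flux i (U j 0) (U j 0)"
    unfolding mass_vol_fluct
    by (rule sum_by_parts_symmetric[OF quadrature]) (rule mass_flux_commute)
  then show ?thesis
    using dgsem_cell_avg[OF scheme linear_mass, of i j]
    by (simp add: mass_fluct_minus mass_fluct_plus)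
qed

end

section \<open>Interface mass fluxes and positivity of the cell averages\<close>

text \<open>The first bound is for the right interface of a cell, where \<open>um\<close> is the
  inner state; the second is for the left interface, where \<open>up\<close> is.\<close>

lemma interface_mass_flux_bounds:
  assumes M: "bn_admissible M" and u: "um \<in> phase_space M" "up \<in> phase_space M"
    and b: "\<bar>vel i um\<bar> \<le> b" "\<bar>vel i up\<bar> \<le> b"
  shows "mass i (num_flux M b um up) - visc_coeff M um up * jump (rho i) um up \<le>
      mass i um * ((b + mean (vel i) um up) * logmean (rho i) um up / (2 * rho i um)
        + visc_coeff M um up / void i um)"
    and "- (mass i up * ((b - mean (vel i) um up) * logmean (rho i) um up / (2 * rho i up)
        + visc_coeff M um up / void i up)) \<le>
      mass i (num_flux M b um up) - visc_coeff M um up * jump (rho i) um up"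
proof -
  let ?v = "mean (vel i) um up" and ?r = "logmean (rho i) um up" and ?e = "visc_coeff M um up"
  have pos: "void i um > 0" "void i up > 0" "rho i um > 0" "rho i up > 0"
    using u by (auto simp: phase_space_def)
  have m: "mass i um = void i um * rho i um" "mass i up = void i up * rho i up"
    using pos by (simp_all add: mass_eq)
  have "\<bar>?v\<bar> \<le> b"
    using b by (auto simp: mean_def)
  then have nonneg: "b - ?v \<ge> 0" "b + ?v \<ge> 0" by auto
  have r: "?r > 0" and e: "?e \<ge> 0"
    using pos logmean_pos visc_coeff_nonneg[OF M u(1)] by auto
  \<comment> \<open>Writing out the mean and the jump of the void fraction splits the flux into a
    part carried by \<open>um\<close> minus a part carried by \<open>up\<close>. Both are
    nonnegative, and dropping either one gives one of the bounds.\<close>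
  have flux: "mass i (num_flux M b um up) - ?e * jump (rho i) um up =
      void i um * (b + ?v) * ?r / 2 + ?e * rho i um
      - (void i up * (b - ?v) * ?r / 2 + ?e * rho i up)"
    by (simp add: mass_num_flux mass_flux_def mean_def[of "void i"] jump_def field_simps)
  have "mass i um * ((b + ?v) * ?r / (2 * rho i um) + ?e / void i um) =
      void i um * (b + ?v) * ?r / 2 + ?e * rho i um"
    "mass i up * ((b - ?v) * ?r / (2 * rho i up) + ?e / void i up) =
      void i up * (b - ?v) * ?r / 2 + ?e * rho i up"
    unfolding m using pos by (simp_all add: field_simps)
  moreover have "0 \<le> void i um * (b + ?v) * ?r / 2 + ?e * rho i um"
    "0 \<le> void i up * (b - ?v) * ?r / 2 + ?e * rho i up"
    using pos r e nonneg by simp_all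
  ultimately show "mass i (num_flux M b um up) - ?e * jump (rho i) um up \<le>
      mass i um * ((b + ?v) * ?r / (2 * rho i um) + ?e / void i um)"
    "- (mass i up * ((b - ?v) * ?r / (2 * rho i up) + ?e / void i up)) \<le>
      mass i (num_flux M b um up) - ?e * jump (rho i) um up"
    unfolding flux by linarith+
qed

theorem theorem5p2:
  fixes M :: bn_model and p n :: nat and s w :: "nat \<Rightarrow> real" and dt h lam :: real
    and U :: "nat \<Rightarrow> int \<Rightarrow> nat \<Rightarrow> state" and bs :: "int \<Rightarrow> real"
  assumes model: "bn_admissible M"
    and quadrature: "gauss_lobatto p s w"
    and steps: "dt > 0" "h > 0" "lam = dt / h"
    and standing: "\<And>j k. k \<le> p \<Longrightarrow> U n j k \<in> phase_space M"
    and positive: "\<And>j k i. k \<le> p \<Longrightarrow> rho i (U n j k) > 0 \<and> void i (U n j k) > 0"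
    and bs: "\<And>j. bs j = beta_loc p (U n) j"
    and scheme: "dgsem_step M p s w lam bs (U n) (U (Suc n))"
    and cfl: "cfl_condition M p s w lam bs (U n)"
  shows "\<forall>i j.
    cell_avg p w (mass i) (U (Suc n)) j > 0 \<and>
    cell_avg p w (void i) (U (Suc n)) j > 0 \<and>
    (let c = (\<lambda>k. w k / 2 - lam * void_rate M p s w bs (U n) j k);
         cR = lam * ((bs j - vel_I M (U n j p)) / 2);
         cL = lam * ((bs (j - 1) + vel_I M (U n j 0)) / 2)
     in cell_avg p w (void i) (U (Suc n)) j =
          (\<Sum>k\<le>p. c k * void i (U n j k)) + cR * void i (U n (j + 1) 0)
            + cL * void i (U n (j - 1) p)
        \<and> (\<forall>k\<le>p. c k \<ge> 0) \<and> cR \<ge> 0 \<and> cL \<ge> 0 \<and> (\<Sum>k\<le>p. c k) + cR + cL = 1)"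
proof -
  have lam: "lam > 0"
    using steps by simp
  have p: "p \<noteq> 0" and w: "\<And>k. k \<le> p \<Longrightarrow> w k > 0"
    using quadrature by (auto simp: gauss_lobatto_def)
  note rates = cfl_rates_less[OF cfl lam w]
  have vel_R: "\<bar>vel i (U n j p)\<bar> \<le> bs j" "\<bar>vel i (U n (j + 1) 0)\<bar> \<le> bs j" for i j
    using abs_vel_le_beta_loc by (simp_all add: bs)
  \<comment> \<open>The left interface of cell \<open>j\<close> is the right interface of cell
    \<open>j - 1\<close>.\<close>
  have vel_L: "\<bar>vel i (U n (j - 1) p)\<bar> \<le> bs (j - 1)" "\<bar>vel i (U n j 0)\<bar> \<le> bs (j - 1)" for i j
    using vel_R[of i "j - 1"] by simp_all
  have mass_pos: "mass i (U n j k) > 0" if "k \<le> p" for i j k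
    using positive[OF that, of i j] by (simp add: mass_eq)
  have mass: "cell_avg p w (mass i) (U (Suc n)) j > 0" for i j
  proof -
    let ?m = "\<lambda>k. mass i (U n j k)"
    let ?R = "mass_rate_right M p bs (U n) i j" and ?L = "mass_rate_left M p bs (U n) i j"
    have "mass i (num_flux M (bs j) (U n j p) (U n (j + 1) 0))
        - visc_coeff M (U n j p) (U n (j + 1) 0) * jump (rho i) (U n j p) (U n (j + 1) 0)
      - (mass i (num_flux M (bs (j - 1)) (U n (j - 1) p) (U n j 0))
        - visc_coeff M (U n (j - 1) p) (U n j 0) * jump (rho i) (U n (j - 1) p) (U n j 0))
      \<le> ?m p * ?R + ?m 0 * ?L"
      using interface_mass_flux_bounds(1)[OF model standing standing vel_R, of i j]
        interface_mass_flux_bounds(2)[OF model standing standing vel_L, of i j]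
      by (simp add: mass_rate_right_def mass_rate_left_def Let_def)
    then have "cell_avg p w (mass i) (U n) j - lam * (?m p * ?R + ?m 0 * ?L)
        \<le> cell_avg p w (mass i) (U (Suc n)) j"
      unfolding mass_update[OF quadrature scheme] using lam by simp
    moreover have "lam * (?m p * ?R + ?m 0 * ?L) < ?m p * (w p / 2) + ?m 0 * (w 0 / 2)"
    proof -
      have "?m p * (lam * ?R) < ?m p * (w p / 2)" "?m 0 * (lam * ?L) < ?m 0 * (w 0 / 2)"
        by (intro mult_strict_left_mono rates mass_pos; simp)+
      then show ?thesis by (simp add: distrib_left mult.left_commute)
    qed
    \<comment> \<open>As \<open>p\<close> is nonzero, the end nodes are distinct: each interface
      loss is charged to a different share of the cell mass, and the other nodes only add
      mass.\<close>
    moreover have "?m p * (w p / 2) + ?m 0 * (w 0 / 2) = (\<Sum>k\<in>{0, p}. w k * ?m k) / 2"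
      using p by (simp add: field_simps)
    moreover have "(\<Sum>k\<in>{0, p}. w k * ?m k) \<le> (\<Sum>k\<le>p. w k * ?m k)"
      by (rule sum_mono2) (auto intro!: mult_nonneg_nonneg less_imp_le[OF w] less_imp_le[OF mass_pos])
    ultimately show ?thesis
      unfolding cell_avg_def by linarith
  qed
  let ?c = "\<lambda>j k. w k / 2 - lam * void_rate M p s w bs (U n) j k"
  let ?R = "\<lambda>j. lam * ((bs j - vel_I M (U n j p)) / 2)"
  let ?L = "\<lambda>j. lam * ((bs (j - 1) + vel_I M (U n j 0)) / 2)"
  have c: "?c j k > 0" if "k \<le> p" for j k
    using rates(1) that by (simp add: w)
  have R: "?R j \<ge> 0" for j
    using abs_vel_I_le[OF model standing vel_R(1), of j] lam by simp
  have L: "?L j \<ge> 0" for j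
    using abs_vel_I_le[OF model standing vel_L(2), of j] lam by simp
  note update = void_update[OF quadrature scheme]
  have void: "cell_avg p w (void i) (U (Suc n)) j > 0" for i j
  proof -
    \<comment> \<open>The strict CFL inequality makes the coefficients inside the cell strictly
      positive, so this sum alone yields positivity; the neighbour coefficients may vanish.\<close>
    have "(\<Sum>k\<le>p. ?c j k * void i (U n j k)) > 0"
      using c positive by (intro sum_pos) auto
    moreover have "?R j * void i (U n (j + 1) 0) \<ge> 0" "?L j * void i (U n (j - 1) p) \<ge> 0"
      using R L positive by (simp_all add: less_imp_le)
    ultimately show ?thesis
      unfolding update by linarith
  qed
  show ?thesis
    unfolding Let_def
    using mass void update void_update_coeffs_sum[OF quadrature scheme] less_imp_le[OF c] R L
    by blast
qed

end
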